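(* For every integer $p>0$, $RE\setminus RC\,INS_1^{1,0}DEL_p^{1,1}\neq\emptyset$. That is, there is a recursively enumerable language that is not generated by any random context insertion-deletion system with insertion and deletion rules of size $(1,1,0;p,1,1)$.
   Context: $\lambda$ denotes the empty string and $RE$ the family of recursively enumerable languages. An insertion rule $(u,\alpha,v)_{ins}$ and a deletion rule $(u,\alpha,v)_{del}$ over an alphabet $V$ are given by strings $u,\alpha,v\in V^*$ with $\alpha\neq\lambda$. For $x,y\in V^*$: $x\Rightarrow_{ins}y$ via $(u,\alpha,v)_{ins}$ if $x=x_1uvx_2$, $y=x_1u\alpha vx_2$ for some $x_1,x_2\in V^*$; $x\Rightarrow_{del}y$ via $(u,\alpha,v)_{del}$ if $x=x_1u\alpha vx_2$, $y=x_1uvx_2$ for some $x_1,x_2\in V^*$. A random context insertion-deletion system is a construct $\gamma=(V,T,A,R)$ where $V$ is a finite alphabet, $T\subseteq V$ is the terminal alphabet, $A\subseteq V^*$ is a finite set of axioms, and $R$ is a finite set of rules of the form $r=\bigl((a,b,c)_t,P,Q\bigr)$, where $t\in\{ins,del\}$, $(a,b,c)_t$ is an insertion rule if $t=ins$ and a deletion rule if $t=del$, and $P,Q\subseteq V$ are sets of letters (the permitting and forbidding conditions; either may be empty). For such a rule $r$, a transition $w\Longrightarrow_r w'$ between strings $w,w'\in V^*$ is performed if $w\Rightarrow_t w'$ via $(a,b,c)_t$, every letter of $P$ occurs in $w$, and no letter of $Q$ occurs in $w$. Let $\Longrightarrow^*$ be the reflexive and transitive closure of the union of the relations $\Longrightarrow_r$,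 $r\in R$. The generated language is $L(\gamma)=\{w\in T^*\mid x\Longrightarrow^* w\text{ for some }x\in A\}$. The system has rules of size $(n,m,m';p,q,q')$ if every insertion rule $(u,\alpha,v)_{ins}$ in it satisfies $|\alpha|\le n$, $|u|\le m$, $|v|\le m'$ and every deletion rule $(u,\alpha,v)_{del}$ in it satisfies $|\alpha|\le p$, $|u|\le q$, $|v|\le q'$. $RC\,INS_n^{m,m'}DEL_p^{q,q'}$ denotes the family of languages generated by random context insertion-deletion systems with rules of size $(n,m,m';p,q,q')$. *)

theory Defs
  imports Main
begin

text \<open>
  Strings over an alphabet \<open>V\<close> are the elements of \<open>lists V\<close>, the empty string is \<open>[]\<close>.
  The type of symbols is a parameter: alphabets (including auxiliary, non-terminal symbols) are
  finite subsets of it, so the language families below are meant to be used with an infinite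
  symbol type such as \<^typ>\<open>nat\<close>.
\<close>

subsection \<open>Recursively enumerable languages\<close>

text \<open>The recursively enumerable languages are those generated by type-0 (unrestricted) grammars.\<close>

record 'a grammar =
  nonterminals :: "'a set"
  terminals :: "'a set"
  start :: 'a
  productions :: "('a list \<times> 'a list) set"

definition type0_grammar :: "'a grammar \<Rightarrow> bool" where
  "type0_grammar G \<longleftrightarrow>
     finite (nonterminals G) \<and> finite (terminals G) \<and>
     nonterminals G \<inter> terminals G = {} \<and>
     start G \<in> nonterminals G \<and>
     finite (productions G) \<and>
     (\<forall>(l, r) \<in> productions G.
        l \<in> lists (nonterminals G \<union> terminals G) \<and> set l \<inter> nonterminals G \<noteq> {} \<and>
        r \<in> lists (nonterminals G \<union> terminals G))"

definition grammar_step :: "'a grammar \<Rightarrow> 'a list \<Rightarrow> 'a list \<Rightarrow> bool" where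
  "grammar_step G x y \<longleftrightarrow>
     (\<exists>l r x1 x2. (l, r) \<in> productions G \<and> x = x1 @ l @ x2 \<and> y = x1 @ r @ x2)"

definition grammar_language :: "'a grammar \<Rightarrow> 'a list set" where
  "grammar_language G = {w \<in> lists (terminals G). (grammar_step G)\<^sup>*\<^sup>* [start G] w}"

definition RE :: "'a list set set" where
  "RE = {L. \<exists>G. type0_grammar G \<and> L = grammar_language G}"

subsection \<open>Random context insertion-deletion systems\<close>

datatype op_kind = Ins | Del

record 'a rc_rule =
  kind :: op_kind
  left_context :: "'a list"
  middle :: "'a list"
  right_context :: "'a list"
  permitting :: "'a set"
  forbidding :: "'a set"

record 'a rc_system =
  alphabet :: "'a set"
  terminal_alphabet :: "'a set"
  axioms :: "'a list set"
  rules :: "'a rc_rule set"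

definition rc_rule_over :: "'a set \<Rightarrow> 'a rc_rule \<Rightarrow> bool" where
  "rc_rule_over V r \<longleftrightarrow>
     left_context r \<in> lists V \<and> middle r \<in> lists V \<and> right_context r \<in> lists V \<and>
     middle r \<noteq> [] \<and> permitting r \<subseteq> V \<and> forbidding r \<subseteq> V"

definition rc_insdel_system :: "'a rc_system \<Rightarrow> bool" where
  "rc_insdel_system \<gamma> \<longleftrightarrow>
     finite (alphabet \<gamma>) \<and>
     terminal_alphabet \<gamma> \<subseteq> alphabet \<gamma> \<and>
     finite (axioms \<gamma>) \<and> axioms \<gamma> \<subseteq> lists (alphabet \<gamma>) \<and>
     finite (rules \<gamma>) \<and> (\<forall>r \<in> rules \<gamma>. rc_rule_over (alphabet \<gamma>) r)"

definition ins_step :: "'a list \<Rightarrow> 'a list \<Rightarrow> 'a list \<Rightarrow> 'a list \<Rightarrow> 'a list \<Rightarrow> bool" where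
  "ins_step u \<alpha> v x y \<longleftrightarrow>
     (\<exists>x1 x2. x = x1 @ u @ v @ x2 \<and> y = x1 @ u @ \<alpha> @ v @ x2)"

definition del_step :: "'a list \<Rightarrow> 'a list \<Rightarrow> 'a list \<Rightarrow> 'a list \<Rightarrow> 'a list \<Rightarrow> bool" where
  "del_step u \<alpha> v x y \<longleftrightarrow>
     (\<exists>x1 x2. x = x1 @ u @ \<alpha> @ v @ x2 \<and> y = x1 @ u @ v @ x2)"

definition rule_step :: "'a rc_rule \<Rightarrow> 'a list \<Rightarrow> 'a list \<Rightarrow> bool" where
  "rule_step r w w' \<longleftrightarrow>
     (case kind r of
        Ins \<Rightarrow> ins_step (left_context r) (middle r) (right_context r) w w'
      | Del \<Rightarrow> del_step (left_context r) (middle r) (right_context r) w w') \<and>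
     permitting r \<subseteq> set w \<and> forbidding r \<inter> set w = {}"

definition rc_step :: "'a rc_system \<Rightarrow> 'a list \<Rightarrow> 'a list \<Rightarrow> bool" where
  "rc_step \<gamma> w w' \<longleftrightarrow>
     w \<in> lists (alphabet \<gamma>) \<and> w' \<in> lists (alphabet \<gamma>) \<and> (\<exists>r \<in> rules \<gamma>. rule_step r w w')"

definition rc_language :: "'a rc_system \<Rightarrow> 'a list set" where
  "rc_language \<gamma> =
     {w \<in> lists (terminal_alphabet \<gamma>). \<exists>x \<in> axioms \<gamma>. (rc_step \<gamma>)\<^sup>*\<^sup>* x w}"

definition has_size ::
  "'a rc_system \<Rightarrow> nat \<Rightarrow> nat \<Rightarrow> nat \<Rightarrow> nat \<Rightarrow> nat \<Rightarrow> nat \<Rightarrow> bool" where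
  "has_size \<gamma> n m m' p q q' \<longleftrightarrow>
     (\<forall>r \<in> rules \<gamma>.
        (kind r = Ins \<longrightarrow>
           length (middle r) \<le> n \<and> length (left_context r) \<le> m \<and> length (right_context r) \<le> m') \<and>
        (kind r = Del \<longrightarrow>
           length (middle r) \<le> p \<and> length (left_context r) \<le> q \<and> length (right_context r) \<le> q'))"

text \<open>
  \<open>RC_INS_DEL n m m' p q q'\<close> is $RC\,INS_n^{m,m'}DEL_p^{q,q'}$.
\<close>

definition RC_INS_DEL :: "nat \<Rightarrow> nat \<Rightarrow> nat \<Rightarrow> nat \<Rightarrow> nat \<Rightarrow> nat \<Rightarrow> 'a list set set" where
  "RC_INS_DEL n m m' p q q' =
     {L. \<exists>\<gamma>. rc_insdel_system \<gamma> \<and> has_size \<gamma> n m m' p q q' \<and> L = rc_language \<gamma>}"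

end

theory Submission
  imports Defs "HOL-Library.Sublist"
begin

text \<open>
  An insertion rule without right context that inserts \<open>a\<close> and does not forbid \<open>a\<close> can be
  applied twice in a row at the same place. Since contexts have length at most one, the pair
  \<open>aa\<close> behaves in the remaining derivation exactly as the single \<open>a\<close> would. So if no word of the
  language has a factor \<open>aa\<close>, each inserted \<open>a\<close> that survives in the generated word was inserted
  into a string free of \<open>a\<close>. Hence either all surviving \<open>a\<close> come from the axiom, or there is
  only one of them. So the number of occurrences of \<open>a\<close> is bounded on the language, and
  \<open>{(ab)\<^sup>n | n \<ge> 0}\<close> is not generated.
\<close>

section \<open>Rule steps as replacement of a factor between contexts\<close>

definition deleted_part :: "'a rc_rule \<Rightarrow> 'a list" where
  "deleted_part r = (case kind r of Ins \<Rightarrow> [] | Del \<Rightarrow> middle r)"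

definition inserted_part :: "'a rc_rule \<Rightarrow> 'a list" where
  "inserted_part r = (case kind r of Ins \<Rightarrow> middle r | Del \<Rightarrow> [])"

text \<open>Insertion and deletion get a common form with one of the two parts empty. The contexts
  become conditions on the end of \<open>s\<close> and the start of \<open>t\<close>, which is where
  doubling a letter has to be checked.\<close>

lemma rule_step_iff:
  "rule_step r x y \<longleftrightarrow>
     (\<exists>s t. suffix (left_context r) s \<and> prefix (right_context r) t \<and>
        x = s @ deleted_part r @ t \<and> y = s @ inserted_part r @ t) \<and>
     permitting r \<subseteq> set x \<and> forbidding r \<inter> set x = {}"
  unfolding rule_step_def ins_step_def del_step_def deleted_part_def inserted_part_def
    suffix_def prefix_def
  by (cases "kind r") (simp, (intro conj_cong refl iffI; (elim exE conjE)?; fastforce))+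

lemma rule_stepI:
  assumes "suffix (left_context r) s" "prefix (right_context r) t"
    and "permitting r \<subseteq> set (s @ deleted_part r @ t)" "forbidding r \<inter> set (s @ deleted_part r @ t) = {}"
  shows "rule_step r (s @ deleted_part r @ t) (s @ inserted_part r @ t)"
  unfolding rule_step_iff using assms by blast

text \<open>A context of length at most one sees only the last letter, and doubling an occurrence of
  \<open>a\<close> leaves the last letter unchanged even when it is that \<open>a\<close>.\<close>

lemma suffix_double:
  assumes "suffix u (y @ a # z)" "length u \<le> 1"
  shows "suffix u (y @ a # a # z)"
proof (cases u)
  case (Cons b u')
  with assms(2) have "u = [b]" by simp
  with assms(1) show ?thesis by (cases z rule: rev_cases) (auto simp: suffix_def)
qed simp

lemma prefix_double:
  assumes "prefix v (y @ a # z)" "length v \<le> 1"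
  shows "prefix v (y @ a # a # z)"
  using assms by (cases v; cases y) auto

section \<open>Occurrences whose doubling leads to a square in a terminal word\<close>

definition has_square :: "'a \<Rightarrow> 'a list \<Rightarrow> bool" where
  "has_square a w \<longleftrightarrow> (\<exists>y z. w = y @ a # a # z)"

text \<open>No axiom appears here, since the doubled strings to which this is applied need not be
  derivable themselves.\<close>

definition yields_square :: "'a rc_system \<Rightarrow> 'a \<Rightarrow> 'a list \<Rightarrow> bool" where
  "yields_square \<gamma> a x \<longleftrightarrow>
     (\<exists>w \<in> lists (terminal_alphabet \<gamma>). (rc_step \<gamma>)\<^sup>*\<^sup>* x w \<and> has_square a w)"

text \<open>
  Includes the positions of those \<open>a\<close> that survive in some derivation of a terminal word; using
  this set avoids tracking individual occurrences along a derivation.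
\<close>

definition doubling_positions :: "'a rc_system \<Rightarrow> 'a \<Rightarrow> 'a list \<Rightarrow> nat set" where
  "doubling_positions \<gamma> a x =
     {length y |y z. x = y @ a # z \<and> yields_square \<gamma> a (y @ a # a # z)}"

lemma doubling_positions_subset:
  "doubling_positions \<gamma> a x \<subseteq> {i. i < length x \<and> x ! i = a}"
  by (auto simp: doubling_positions_def)

lemma finite_doubling_positions: "finite (doubling_positions \<gamma> a x)"
  by (rule finite_subset[OF doubling_positions_subset]) simp

text \<open>Doubling a letter of a terminal word gives a terminal word that already contains the
  square, so the empty derivation suffices.\<close>

lemma doubling_positions_terminal:
  assumes "w \<in> lists (terminal_alphabet \<gamma>)"
  shows "doubling_positions \<gamma> a w = {i. i < length w \<and> w ! i = a}"
proof (intro equalityI doubling_positions_subset subsetI)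
  fix i assume "i \<in> {i. i < length w \<and> w ! i = a}"
  then have i: "i < length w" "w ! i = a" by auto
  define y z where "y = take i w" and "z = drop (Suc i) w"
  have w: "w = y @ a # z" "length y = i"
    using i id_take_nth_drop[of i w] by (auto simp: y_def z_def)
  have "yields_square \<gamma> a (y @ a # a # z)"
    unfolding yields_square_def has_square_def using assms w
    by (intro bexI[of _ "y @ a # a # z"]) auto
  with w show "i \<in> doubling_positions \<gamma> a w" by (auto simp: doubling_positions_def)
qed

lemma rc_step_yields_square:
  "rc_step \<gamma> x y \<Longrightarrow> yields_square \<gamma> a y \<Longrightarrow> yields_square \<gamma> a x"
  unfolding yields_square_def by (meson converse_rtranclp_into_rtranclp)

text \<open>An occurrence outside the inserted part lies in \<open>s\<close> or \<open>t\<close> and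
  hence is present in \<open>x\<close>. Doubling it there preserves the contexts and the set of
  letters, so the same rule leads from the doubled \<open>x\<close> to the doubled \<open>y\<close>.
  The map shifts positions in \<open>t\<close>; its values on the deleted part are irrelevant, as
  only an inclusion in the image is claimed.\<close>

lemma doubling_positions_step:
  assumes r: "r \<in> rules \<gamma>" "length (left_context r) \<le> 1" "length (right_context r) \<le> 1"
    and ctx: "suffix (left_context r) s" "prefix (right_context r) t"
      "permitting r \<subseteq> set x" "forbidding r \<inter> set x = {}"
    and x: "x = s @ deleted_part r @ t" "x \<in> lists (alphabet \<gamma>)"
    and y: "y = s @ inserted_part r @ t" "y \<in> lists (alphabet \<gamma>)"
    and i: "i \<in> doubling_positions \<gamma> a y"
      "\<not> (length s \<le> i \<and> i < length s + length (inserted_part r))"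
  shows "i \<in> (\<lambda>j. if j < length s then j
               else j - length (deleted_part r) + length (inserted_part r))
           ` doubling_positions \<gamma> a x"
proof -
  obtain y1 y2 where y12: "y = y1 @ a # y2" "length y1 = i" "yields_square \<gamma> a (y1 @ a # a # y2)"
    using i by (auto simp: doubling_positions_def)
  consider "i < length s" | "i \<ge> length s + length (inserted_part r)" using i by linarith
  then show ?thesis
  proof cases
    case 1
    have "y1 @ a # y2 = s @ inserted_part r @ t" using y y12 by simp
    with 1 y12(2) obtain q where q: "s = y1 @ a # q" "y2 = q @ inserted_part r @ t"
      by (auto simp: append_eq_append_conv2 Cons_eq_append_conv)
    let ?x = "(y1 @ a # a # q) @ deleted_part r @ t"
    let ?y = "(y1 @ a # a # q) @ inserted_part r @ t"
    have "suffix (left_context r) (y1 @ a # a # q)"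
      using suffix_double ctx(1) r(2) q(1) by metis
    moreover have "set ?x = set x" using x q by auto
    ultimately have "rule_step r ?x ?y"
      using ctx by (intro rule_stepI) simp_all
    then have "rc_step \<gamma> ?x ?y"
      unfolding rc_step_def using r x y q by auto
    then have "yields_square \<gamma> a ?x"
      using rc_step_yields_square y12(3) q by fastforce
    then have "i \<in> doubling_positions \<gamma> a x"
      unfolding doubling_positions_def using x q y12(2) by auto
    with 1 show ?thesis by force
  next
    case 2
    have "y1 @ a # y2 = (s @ inserted_part r) @ t" using y y12 by simp
    moreover have "length (s @ inserted_part r) \<le> length y1" using 2 y12(2) by simp
    ultimately have "prefix (s @ inserted_part r) y1"
      by (metis prefix_length_prefix prefixI)
    then obtain q where q: "y1 = s @ inserted_part r @ q" "t = q @ a # y2"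
      using \<open>y1 @ a # y2 = (s @ inserted_part r) @ t\<close> by (auto simp: prefix_def)
    let ?x = "s @ deleted_part r @ (q @ a # a # y2)"
    let ?y = "s @ inserted_part r @ (q @ a # a # y2)"
    have "prefix (right_context r) (q @ a # a # y2)"
      using prefix_double ctx(2) r(3) q(2) by metis
    moreover have "set ?x = set x" using x q by auto
    ultimately have "rule_step r ?x ?y"
      using ctx by (intro rule_stepI) simp_all
    then have "rc_step \<gamma> ?x ?y"
      unfolding rc_step_def using r x y q by auto
    then have "yields_square \<gamma> a ?x"
      using rc_step_yields_square y12(3) q by fastforce
    then have "length (s @ deleted_part r @ q) \<in> doubling_positions \<gamma> a x"
      unfolding doubling_positions_def using x q
      by (intro CollectI exI[of _ "s @ deleted_part r @ q"] exI[of _ y2]) auto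
    then show ?thesis
      by (rule rev_image_eqI) (use q y12(2) in auto)
  qed
qed

text \<open>If no doubling position of \<open>y\<close> is newly inserted, all of them are images of
  doubling positions of \<open>x\<close>. Otherwise the rule must forbid \<open>a\<close>, which
  leaves the new occurrence as the only one; this is where the 1 in the bound comes from.\<close>

lemma card_doubling_positions_step:
  assumes \<gamma>: "rc_insdel_system \<gamma>" "has_size \<gamma> 1 1 0 p 1 1"
    and square_free: "\<And>w. w \<in> rc_language \<gamma> \<Longrightarrow> \<not> has_square a w"
    and reach: "x0 \<in> axioms \<gamma>" "(rc_step \<gamma>)\<^sup>*\<^sup>* x0 x" and step: "rc_step \<gamma> x y"
  shows "card (doubling_positions \<gamma> a y) \<le> max 1 (card (doubling_positions \<gamma> a x))"
proof -
  obtain r where r: "r \<in> rules \<gamma>" "rule_step r x y"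
    and V: "x \<in> lists (alphabet \<gamma>)" "y \<in> lists (alphabet \<gamma>)"
    using step by (auto simp: rc_step_def)
  obtain s t where st: "suffix (left_context r) s" "prefix (right_context r) t"
      "x = s @ deleted_part r @ t" "y = s @ inserted_part r @ t"
    and ctx: "permitting r \<subseteq> set x" "forbidding r \<inter> set x = {}"
    using r(2) unfolding rule_step_iff by blast
  have size: "kind r = Ins \<Longrightarrow> length (middle r) \<le> 1 \<and> length (left_context r) \<le> 1 \<and> right_context r = []"
    "kind r = Del \<Longrightarrow> length (left_context r) \<le> 1 \<and> length (right_context r) \<le> 1"
    using bspec[OF \<gamma>(2)[unfolded has_size_def] r(1)] by simp_all
  then have short: "length (left_context r) \<le> 1" "length (right_context r) \<le> 1"
    by (cases "kind r"; simp)+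
  show ?thesis
  proof (cases "\<exists>i \<in> doubling_positions \<gamma> a y.
                  length s \<le> i \<and> i < length s + length (inserted_part r)")
    case False
    define f where "f j = (if j < length s then j
      else j - length (deleted_part r) + length (inserted_part r))" for j
    have "doubling_positions \<gamma> a y \<subseteq> f ` doubling_positions \<gamma> a x"
      using doubling_positions_step[OF r(1) short st(1,2) ctx st(3) V(1) st(4) V(2)] False
      unfolding f_def by blast
    then have "card (doubling_positions \<gamma> a y) \<le> card (doubling_positions \<gamma> a x)"
      by (rule surj_card_le[OF finite_doubling_positions])
    then show ?thesis by simp
  next
    case True
    then obtain i where i: "i \<in> doubling_positions \<gamma> a y"
      "length s \<le> i" "i < length s + length (inserted_part r)" by blast
    then have ins: "kind r = Ins"
      by (cases "kind r") (auto simp: inserted_part_def)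
    have "length (middle r) \<le> 1" and right: "right_context r = []"
      using size(1) ins by simp_all
    then obtain c where c: "middle r = [c]"
      using i(3) ins i(2) by (cases "middle r") (auto simp: inserted_part_def)
    have parts: "inserted_part r = [c]" "deleted_part r = []"
      using ins c by (auto simp: inserted_part_def deleted_part_def)
    obtain y1 y2 where y12: "y = y1 @ a # y2" "length y1 = i" "yields_square \<gamma> a (y1 @ a # a # y2)"
      using i(1) by (auto simp: doubling_positions_def)
    have "length y1 = length s" using i(2,3) parts y12(2) by simp
    then have eq: "y1 = s" "c = a" "y2 = t"
      using st(4) y12(1) parts by simp_all
    have forbids: "a \<in> forbidding r"
    proof (rule ccontr)
      assume notin: "a \<notin> forbidding r"
      \<comment> \<open>The rule is applied to \<open>y\<close> at the same place: with an empty
        right context it can insert a second \<open>a\<close> before the first, and the only letter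
        that \<open>y\<close> may have in addition to those of \<open>x\<close> is \<open>a\<close>,
        which is assumed not to be forbidden.\<close>
      have y: "y = s @ deleted_part r @ a # t" using y12(1) eq parts by simp
      have "set y = insert a (set x)" using y st(3) by auto
      then have "rule_step r y (s @ inserted_part r @ a # t)"
        unfolding y using st(1) ctx right notin by (intro rule_stepI) auto
      moreover have "s @ inserted_part r @ a # t \<in> lists (alphabet \<gamma>)"
        using V(2) y12(1) eq parts by simp
      ultimately have "rc_step \<gamma> y (s @ inserted_part r @ a # t)"
        unfolding rc_step_def using r(1) V(2) by blast
      moreover have "yields_square \<gamma> a (s @ inserted_part r @ a # t)"
        using y12(3) eq parts by simp
      ultimately have "yields_square \<gamma> a y"
        by (rule rc_step_yields_square)
      then obtain w where w: "w \<in> lists (terminal_alphabet \<gamma>)" "(rc_step \<gamma>)\<^sup>*\<^sup>* y w" "has_square a w"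
        unfolding yields_square_def by blast
      \<comment> \<open>Unlike an arbitrary doubled string, \<open>y\<close> is reachable from an
        axiom, so the square lands in a word of the language.\<close>
      have "(rc_step \<gamma>)\<^sup>*\<^sup>* x0 w"
        using reach(2) step w(2) by (meson rtranclp.rtrancl_into_rtrancl rtranclp_trans)
      then have "w \<in> rc_language \<gamma>"
        using w(1) reach(1) unfolding rc_language_def by blast
      then show False using square_free w(3) by blast
    qed
    then have "a \<notin> set x" using ctx(2) by blast
    then have "a \<notin> set s" "a \<notin> set t" using st(3) by simp_all
    then have "y = y' @ a # z' \<Longrightarrow> y' = s" for y' z'
      using y12(1) eq append_Cons_eq_iff[of a s t y' z'] by simp
    then have "doubling_positions \<gamma> a y \<subseteq> {length s}"
      unfolding doubling_positions_def by blast
    then have "card (doubling_positions \<gamma> a y) \<le> card {length s}"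
      by (intro card_mono) auto
    then show ?thesis by simp
  qed
qed

text \<open>The number of doubling positions never exceeds the larger of 1 and its maximum over the
  finitely many axioms, and in a generated word every \<open>a\<close> is at a doubling
  position.\<close>

lemma count_list_bounded_of_square_free:
  assumes L: "L \<in> RC_INS_DEL 1 1 0 p 1 1"
    and square_free: "\<And>w. w \<in> L \<Longrightarrow> \<not> has_square a w"
  shows "\<exists>N. \<forall>w \<in> L. count_list w a \<le> N"
proof -
  obtain \<gamma> where \<gamma>: "rc_insdel_system \<gamma>" "has_size \<gamma> 1 1 0 p 1 1" and L_eq: "L = rc_language \<gamma>"
    using L unfolding RC_INS_DEL_def by blast
  have "finite (axioms \<gamma>)" using \<gamma>(1) by (simp add: rc_insdel_system_def)
  then obtain M where M: "\<And>x. x \<in> axioms \<gamma> \<Longrightarrow> card (doubling_positions \<gamma> a x) \<le> M"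
    using finite_nat_set_iff_bounded_le[of "(\<lambda>x. card (doubling_positions \<gamma> a x)) ` axioms \<gamma>"]
    by auto
  have bound: "card (doubling_positions \<gamma> a x) \<le> max 1 M"
    if "(rc_step \<gamma>)\<^sup>*\<^sup>* x0 x" "x0 \<in> axioms \<gamma>" for x0 x
    using that
  proof (induction rule: rtranclp_induct)
    case base
    then show ?case using M by (simp add: le_max_iff_disj)
  next
    case (step x y)
    then have "card (doubling_positions \<gamma> a y) \<le> max 1 (card (doubling_positions \<gamma> a x))"
      using card_doubling_positions_step[OF \<gamma> square_free[unfolded L_eq]] by blast
    with step show ?case by simp
  qed
  have "count_list w a \<le> max 1 M" if wL: "w \<in> L" for w
  proof -
    obtain x0 where w: "w \<in> lists (terminal_alphabet \<gamma>)" "x0 \<in> axioms \<gamma>" "(rc_step \<gamma>)\<^sup>*\<^sup>* x0 w"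
      using wL unfolding L_eq rc_language_def by blast
    have "count_list w a = card {i. i < length w \<and> w ! i = a}"
      by (simp add: count_list_eq_length_filter length_filter_conv_card eq_commute)
    also have "\<dots> \<le> max 1 M"
      using bound[OF w(3,2)] doubling_positions_terminal[OF w(1)] by simp
    finally show ?thesis .
  qed
  then show ?thesis by blast
qed

section \<open>The alternating words and a grammar for them\<close>

definition alternating_word :: "nat \<Rightarrow> nat list" where
  "alternating_word n = concat (replicate n [0, 1])"

lemma alternating_word_simps:
  "alternating_word 0 = []"
  "alternating_word (Suc n) = 0 # 1 # alternating_word n"
  by (simp_all add: alternating_word_def)

lemma alternating_word_Suc_append: "alternating_word (Suc n) = alternating_word n @ [0, 1]"
  by (induction n) (simp_all add: alternating_word_simps)

lemma set_alternating_word: "set (alternating_word n) \<subseteq> {0, 1}"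
  by (induction n) (auto simp: alternating_word_simps)

lemma count_list_alternating_word: "count_list (alternating_word n) 0 = n"
  by (induction n) (simp_all add: alternating_word_simps)

lemma alternating_word_square_free: "\<not> has_square 0 (alternating_word n)"
proof (induction n)
  case (Suc n)
  show ?case
  proof
    assume "has_square 0 (alternating_word (Suc n))"
    then obtain y z where eq: "0 # 1 # alternating_word n = y @ 0 # 0 # z"
      unfolding has_square_def alternating_word_simps by blast
    \<comment> \<open>The letter 1 in second place keeps the square from starting at either of the
      first two letters.\<close>
    then obtain y' where "alternating_word n = y' @ 0 # 0 # z"
      by (cases y; cases "tl y") auto
    with Suc show False unfolding has_square_def by blast
  qed
qed (simp add: has_square_def alternating_word_simps)

definition alternating_grammar :: "nat grammar" where
  "alternating_grammar =
     \<lparr>nonterminals = {2}, terminals = {0, 1}, start = 2, productions = {([2], [0, 1, 2]), ([2], [])}\<rparr>"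

lemma type0_alternating_grammar: "type0_grammar alternating_grammar"
  by (auto simp: type0_grammar_def alternating_grammar_def)

text \<open>The grammar is right-linear: its single nonterminal \<open>2\<close> stays at the right
  end until it is erased.\<close>

lemma alternating_grammar_sentential_form:
  assumes "(grammar_step alternating_grammar)\<^sup>*\<^sup>* [2] w"
  shows "\<exists>n. w = alternating_word n \<or> w = alternating_word n @ [2]"
  using assms
proof (induction rule: rtranclp_induct)
  case base
  show ?case by (rule exI[of _ 0]) (simp add: alternating_word_simps)
next
  case (step v w)
  obtain n where n: "v = alternating_word n \<or> v = alternating_word n @ [2]"
    using step.IH by blast
  obtain x1 x2 where v: "v = x1 @ 2 # x2" and w: "w = x1 @ [0, 1, 2] @ x2 \<or> w = x1 @ x2"
    using step.hyps(2) by (auto simp: grammar_step_def alternating_grammar_def)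
  have no2: "2 \<notin> set (alternating_word n)" using set_alternating_word[of n] by auto
  then have "v = alternating_word n @ [2]"
    using n v by (metis in_set_conv_decomp)
  \<comment> \<open>The letter \<open>2\<close> occurs only once in \<open>v\<close>, so the place
    of rewriting is determined.\<close>
  then have "x1 = alternating_word n" "x2 = []"
    using v no2 append_Cons_eq_iff[of 2 "alternating_word n" "[]" x1 x2] by auto
  then have "w = alternating_word (Suc n) @ [2] \<or> w = alternating_word n"
    using w alternating_word_Suc_append[of n] by simp
  then show ?case by blast
qed

lemma grammar_language_alternating:
  "grammar_language alternating_grammar = range alternating_word"
proof (intro equalityI subsetI)
  fix w assume w: "w \<in> grammar_language alternating_grammar"
  then have "2 \<notin> set w"
    by (auto simp: grammar_language_def alternating_grammar_def)
  moreover have "\<exists>n. w = alternating_word n \<or> w = alternating_word n @ [2]"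
    using w by (intro alternating_grammar_sentential_form)
      (simp add: grammar_language_def alternating_grammar_def)
  ultimately show "w \<in> range alternating_word" by auto
next
  let ?R = "grammar_step alternating_grammar"
  fix w assume "w \<in> range alternating_word"
  then obtain n where w: "w = alternating_word n" by blast
  have "?R\<^sup>*\<^sup>* [2] (alternating_word n @ [2])" for n
  proof (induction n)
    case (Suc n)
    have "?R (alternating_word n @ [2]) (alternating_word (Suc n) @ [2])"
      unfolding grammar_step_def alternating_word_Suc_append
      by (intro exI[of _ "[2]"] exI[of _ "[0, 1, 2]"] exI[of _ "alternating_word n"] exI[of _ "[]"])
        (simp add: alternating_grammar_def)
    with Suc show ?case by (rule rtranclp.rtrancl_into_rtrancl)
  qed (simp add: alternating_word_simps)
  moreover have "?R (alternating_word n @ [2]) w"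
    unfolding grammar_step_def w
    by (intro exI[of _ "[2]"] exI[of _ "[]"] exI[of _ "alternating_word n"])
      (simp add: alternating_grammar_def)
  ultimately have "?R\<^sup>*\<^sup>* [2] w" by (rule rtranclp.rtrancl_into_rtrancl)
  then show "w \<in> grammar_language alternating_grammar"
    using set_alternating_word[of n] w
    by (auto simp: grammar_language_def alternating_grammar_def)
qed

theorem theorem4:
  fixes p :: nat
  assumes "p > 0"
  shows "(RE :: nat list set set) - RC_INS_DEL 1 1 0 p 1 1 \<noteq> {}"
proof -
  have "range alternating_word \<in> RE"
    unfolding RE_def
    by (intro CollectI exI[of _ alternating_grammar] conjI type0_alternating_grammar
          grammar_language_alternating[symmetric])
  moreover have "range alternating_word \<notin> RC_INS_DEL 1 1 0 p 1 1"
  proof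
    assume "range alternating_word \<in> RC_INS_DEL 1 1 0 p 1 1"
    moreover have "\<not> has_square 0 w" if "w \<in> range alternating_word" for w
      using that alternating_word_square_free by auto
    ultimately have "\<exists>N. \<forall>w \<in> range alternating_word. count_list w 0 \<le> N"
      by (rule count_list_bounded_of_square_free)
    then obtain N where "\<forall>w \<in> range alternating_word. count_list w 0 \<le> N" ..
    \<comment> \<open>The word with \<open>Suc N\<close> zeros exceeds the supposed bound.\<close>
    then have "count_list (alternating_word (Suc N)) 0 \<le> N" by simp
    then show False by (simp add: count_list_alternating_word)
  qed
  ultimately show ?thesis by blast
qed

end
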